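(* Let $p$ be a prime and let $k$ be a positive integer with $k \mid p-1$. The value of the least $k$-th power non-residue in an arithmetic progression $\{bn+c\}_{n=0,1,\ldots}$ over $\mathbb{F}_p$ is bounded by $$\frac{7}{\sqrt{5}} \cdot b \cdot \sqrt{\frac{p-1}{k}} + 4b + c .$$
   Context: $\mathbb{F}_p$ is the prime field with $p$ elements. An element $a \in \mathbb{F}_p$ is called a $k$-th power non-residue if there is no $y \in \mathbb{F}_p$ such that $y^k = a$. The terms $bn+c$ of the arithmetic progression are regarded as elements of $\mathbb{F}_p$ when asking whether they are $k$-th power non-residues. *)

theory Defs
  imports "HOL-Number_Theory.Number_Theory"
begin

definition kth_power_nonresidue :: "nat \<Rightarrow> nat \<Rightarrow> int \<Rightarrow> bool" where
  "kth_power_nonresidue p k a \<longleftrightarrow>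
     a \<in> carrier (residue_ring (int p)) \<and>
     \<not> (\<exists>y \<in> carrier (residue_ring (int p)). y [^]\<^bsub>residue_ring (int p)\<^esub> k = a)"

(* The elements are the integers b n + c themselves, since the bound concerns their size;
   only the non-residue test reduces them modulo p. *)
definition ap_nonresidues :: "nat \<Rightarrow> nat \<Rightarrow> int \<Rightarrow> int \<Rightarrow> int set" where
  "ap_nonresidues p k b c =
     {b * int n + c | n. kth_power_nonresidue p k ((b * int n + c) mod int p)}"

definition is_least_of :: "int \<Rightarrow> int set \<Rightarrow> bool" where
  "is_least_of m S \<longleftrightarrow> m \<in> S \<and> (\<forall>x\<in>S. m \<le> x)"

end

theory Submission
  imports Defs "HOL-Computational_Algebra.Polynomial_Factorial"
begin

text \<open>
  Stepanov's method, in the form of Hanson and Petridis. Put \<open>m = (p - 1) / k\<close> and suppose that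
  \<open>c + b i\<close> is zero or a \<open>k\<close>-th power modulo \<open>p\<close> for all \<open>i < 2 s\<close>, so that
  \<open>(c + b i)^(m + h) = (c + b i)^h\<close> for \<open>h > 0\<close>. Let \<open>\<Delta>\<close> be the difference operator with step \<open>b\<close>.
  The polynomial \<open>\<Delta>^s x^(m + s) - b^s s!\<close> has degree \<open>m\<close> and leading coefficient
  \<open>binomial (m + s) m * b^s * s!\<close>, which is nonzero modulo \<open>p\<close> when \<open>m + s < p\<close>. At each of the
  \<open>s\<close> points \<open>c + b j\<close>, \<open>j < s\<close>, its Taylor coefficients of order below \<open>s\<close> agree modulo \<open>p\<close>
  with those of multiples of \<open>\<Delta>^s x^(s - t)\<close>, and hence vanish. Counting zeros with multiplicity gives
  \<open>s^2 \<le> m\<close>; taking \<open>s = \<lfloor>sqrt m\<rfloor> + 1\<close> bounds a run of residues by \<open>2 sqrt m + 1\<close>, and \<open>2 < 7 / sqrt 5\<close>.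
\<close>

section \<open>Finite differences of powers\<close>

text \<open>Induction on \<open>s\<close>: the absorption identity for
  \<open>Suc s choose Suc i\<close> removes one factor of the power, and expanding the remaining
  \<open>(i + 1) ^ l\<close> leaves moments of order at most \<open>s\<close>.\<close>

lemma alternating_binomial_moment:
  "j \<le> s \<Longrightarrow> (\<Sum>i\<le>s. (-1) ^ (s + i) * of_nat (s choose i) * of_nat i ^ j) =
     (if j = s then fact s else 0 :: 'a :: {comm_ring_1, ring_char_0})"
proof (induction s arbitrary: j)
  case 0
  then show ?case by simp
next
  case (Suc s)
  show ?case
  proof (cases j)
    case 0
    have "(\<Sum>i\<le>Suc s. (-1) ^ (Suc s + i) * of_nat (Suc s choose i)) =
        (-1) ^ Suc s * (\<Sum>i\<le>Suc s. (-1) ^ i * of_nat (Suc s choose i) :: 'a)"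
      by (simp only: sum_distrib_left power_add mult.assoc)
    also have "\<dots> = 0"
      by (subst choose_alternating_sum) simp_all
    finally show ?thesis
      using 0 by simp
  next
    case (Suc l)
    have l: "l \<le> s"
      using Suc Suc.prems by simp
    have eq: "of_nat (Suc s choose Suc i) * of_nat (Suc i) =
        (of_nat (Suc s) * of_nat (s choose i) :: 'a)" for i
      by (metis Suc_times_binomial_eq mult.commute of_nat_mult)
    have "(\<Sum>i\<le>Suc s. (-1) ^ (Suc s + i) * of_nat (Suc s choose i) * of_nat i ^ j) =
        (\<Sum>i\<le>s. (-1) ^ (s + i) * (of_nat (Suc s choose Suc i) * of_nat (Suc i)) * of_nat (Suc i) ^ l :: 'a)"
      unfolding sum.atMost_Suc_shift Suc by (simp add: mult_ac del: binomial_Suc_Suc of_nat_Suc)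
    also have "\<dots> = (\<Sum>i\<le>s. \<Sum>h\<le>l. of_nat (Suc s) * (of_nat (l choose h) *
        ((-1) ^ (s + i) * of_nat (s choose i) * of_nat i ^ h)))"
      unfolding eq
      unfolding of_nat_Suc[of "i" for i] add.commute[of 1] binomial_ring
      by (simp add: sum_distrib_left mult_ac)
    also have "\<dots> = (\<Sum>h\<le>l. of_nat (Suc s) * (of_nat (l choose h) *
        (\<Sum>i\<le>s. (-1) ^ (s + i) * of_nat (s choose i) * of_nat i ^ h)))"
      by (subst sum.swap) (simp only: sum_distrib_left)
    also have "\<dots> = (\<Sum>h\<le>l. if h = s then of_nat (Suc s) * of_nat (l choose h) * fact s else 0)"
      using l by (intro sum.cong refl) (simp add: Suc.IH)
    also have "\<dots> = (if j = Suc s then fact (Suc s) else 0)"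
      using l Suc by (auto simp: sum.delta)
    finally show ?thesis .
  qed
qed

text \<open>Expanding in powers of \<open>b * i\<close> gives moments of order at most
  \<open>j\<close>; only order \<open>s\<close> survives, so the value does not depend on
  \<open>x\<close>.\<close>

lemma finite_difference_power:
  fixes x b :: "'a :: {comm_ring_1, ring_char_0}"
  assumes "j \<le> s"
  shows "(\<Sum>i\<le>s. (-1) ^ (s + i) * of_nat (s choose i) * (x + b * of_nat i) ^ j) =
     (if j = s then b ^ s * fact s else 0)"
proof -
  have "(\<Sum>i\<le>s. (-1) ^ (s + i) * of_nat (s choose i) * (x + b * of_nat i) ^ j) =
      (\<Sum>i\<le>s. \<Sum>h\<le>j. of_nat (j choose h) * b ^ h * x ^ (j - h) *
        ((-1) ^ (s + i) * of_nat (s choose i) * of_nat i ^ h))"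
    unfolding add.commute[of x] binomial_ring
    by (simp add: sum_distrib_left power_mult_distrib mult_ac)
  also have "\<dots> = (\<Sum>h\<le>j. of_nat (j choose h) * b ^ h * x ^ (j - h) *
      (\<Sum>i\<le>s. (-1) ^ (s + i) * of_nat (s choose i) * of_nat i ^ h))"
    by (subst sum.swap) (simp only: sum_distrib_left)
  also have "\<dots> = (\<Sum>h\<le>j. if h = s then of_nat (j choose h) * b ^ h * x ^ (j - h) * fact s else 0)"
    using assms by (intro sum.cong refl) (simp add: alternating_binomial_moment)
  also have "\<dots> = (if j = s then b ^ s * fact s else 0)"
    using assms by (auto simp: sum.delta)
  finally show ?thesis .
qed

section \<open>Zeros with multiplicity modulo a prime\<close>

text \<open>
  Polynomials over the field with \<open>p\<close> elements are represented by integer polynomials, with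
  \<open>[:p:] dvd F\<close> expressing that \<open>F\<close> vanishes modulo \<open>p\<close>.
\<close>

lemma cancel_linear_power_mod:
  fixes M Q R :: "int poly"
  assumes p: "prime p" and M: "\<not> p dvd poly M u"
    and dvd: "[:p:] dvd M * Q - [:-u, 1:] ^ s * R"
  shows "\<exists>Q'. [:p:] dvd Q - [:-u, 1:] ^ s * Q'"
  using dvd
proof (induction s arbitrary: Q)
  case 0
  then show ?case by (intro exI[of _ Q]) simp
next
  case (Suc s)
  have pe: "prime_elem [:p:]"
    using p by (intro lift_prime_elem_poly) auto
  obtain D where D: "M * Q - [:-u, 1:] ^ Suc s * R = [:p:] * D"
    using Suc.prems by (elim dvdE)
  \<comment> \<open>Evaluation at \<open>u\<close> kills \<open>[:-u, 1:] ^ Suc s\<close>, so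
    \<open>p\<close> divides \<open>poly Q u\<close> and \<open>Q\<close> is a multiple of the
    linear factor modulo \<open>p\<close>. One such factor can then be cancelled, because
    \<open>[:p:]\<close> is prime.\<close>
  have "poly M u * poly Q u = p * poly D u"
    using arg_cong[OF D, of "\<lambda>f. poly f u"] by simp
  then have "p dvd poly Q u"
    using M p by (metis dvd_triv_left prime_dvd_mult_iff)
  then obtain a where a: "poly Q u = p * a" ..
  have "[:-u, 1:] dvd Q - [:poly Q u:]"
    by (simp add: poly_eq_0_iff_dvd[symmetric])
  then obtain Q1 where "Q - [:poly Q u:] = [:-u, 1:] * Q1" ..
  then have Q: "Q = [:-u, 1:] * Q1 + [:p:] * [:a:]"
    by (simp add: a algebra_simps)
  have "[:-u, 1:] * (M * Q1 - [:-u, 1:] ^ s * R) = [:p:] * (D - M * [:a:])"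
    using D unfolding Q power_Suc by (simp only: algebra_simps)
  then have "[:p:] dvd [:-u, 1:] * (M * Q1 - [:-u, 1:] ^ s * R)"
    by (metis dvd_triv_left)
  moreover have "\<not> p dvd coeff [:-u, 1:] (Suc 0)"
    using not_prime_unit p by auto
  then have "\<not> [:p:] dvd [:-u, 1:]"
    unfolding const_poly_dvd_iff by blast
  ultimately have "[:p:] dvd M * Q1 - [:-u, 1:] ^ s * R"
    using pe prime_elem_dvd_mult_iff by blast
  from Suc.IH[OF this] obtain Q' where Q': "[:p:] dvd Q1 - [:-u, 1:] ^ s * Q'" ..
  have "Q - [:-u, 1:] ^ Suc s * Q' = [:-u, 1:] * (Q1 - [:-u, 1:] ^ s * Q') + [:p:] * [:a:]"
    unfolding power_Suc by (subst Q) (simp only: algebra_simps)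
  also have "[:p:] dvd \<dots>"
    using Q' by (intro dvd_add dvd_mult dvd_triv_left)
  finally show ?case by blast
qed

text \<open>The powers are collected one point at a time: the product \<open>M\<close> of the
  earlier ones is nonzero modulo \<open>p\<close> at the new point, so the next power must divide
  the cofactor \<open>Q\<close>.\<close>

lemma prod_linear_powers_dvd_mod:
  fixes F :: "int poly" and u :: "'a \<Rightarrow> int"
  assumes p: "prime p" and "finite J"
    and "\<And>i j. i \<in> J \<Longrightarrow> j \<in> J \<Longrightarrow> i \<noteq> j \<Longrightarrow> \<not> p dvd u i - u j"
    and "\<And>j. j \<in> J \<Longrightarrow> \<exists>Q. [:p:] dvd F - [:-u j, 1:] ^ s * Q"
  shows "\<exists>Q. [:p:] dvd F - (\<Prod>j\<in>J. [:-u j, 1:] ^ s) * Q"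
  using assms(2-)
proof (induction J rule: finite_induct)
  case empty
  then show ?case by (intro exI[of _ F]) simp
next
  case (insert j J)
  define M where "M = (\<Prod>j\<in>J. [:-u j, 1:] ^ s)"
  from insert obtain Q where Q: "[:p:] dvd F - M * Q"
    unfolding M_def by blast
  from insert obtain R where R: "[:p:] dvd F - [:-u j, 1:] ^ s * R"
    by blast
  have "[:p:] dvd M * Q - [:-u j, 1:] ^ s * R"
    using dvd_diff[OF R Q] by (simp add: algebra_simps)
  moreover have "\<not> p dvd poly M (u j)"
  proof
    assume "p dvd poly M (u j)"
    then obtain i where "i \<in> J" "p dvd (u j - u i) ^ s"
      unfolding M_def using p insert.hyps
      by (auto simp: poly_prod prime_dvd_prod_iff)
    then show False
      using insert.prems(1)[of j i] insert.hyps p by (auto dest: prime_dvd_power)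
  qed
  ultimately obtain Q' where Q': "[:p:] dvd Q - [:-u j, 1:] ^ s * Q'"
    using cancel_linear_power_mod[OF p] by blast
  have "F - (\<Prod>j\<in>insert j J. [:-u j, 1:] ^ s) * Q' =
      (F - M * Q) + M * (Q - [:-u j, 1:] ^ s * Q')"
    using insert.hyps by (simp add: M_def algebra_simps)
  also have "[:p:] dvd \<dots>"
    using Q Q' by (intro dvd_add dvd_mult)
  finally show ?case by blast
qed

text \<open>Subtracting a suitable multiple of \<open>p\<close> from \<open>F\<close> turns the
  congruence into divisibility by \<open>M\<close> over the integers, which the degree permits only
  for zero.\<close>

lemma monic_multiple_mod_degree:
  fixes F M Q :: "int poly"
  assumes M: "lead_coeff M = 1" and deg: "degree F < degree M"
    and dvd: "[:p:] dvd F - M * Q"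
  shows "[:p:] dvd F"
proof -
  obtain R where R: "F - M * Q = [:p:] * R"
    using dvd ..
  \<comment> \<open>Since \<open>M\<close> is monic, pseudo-division is ordinary division with
    remainder over the integers.\<close>
  obtain A B where AB: "pseudo_divmod R M = (A, B)"
    by fastforce
  have M0: "M \<noteq> 0"
    using M by auto
  have eq: "R = M * A + B" and B: "degree B < degree M"
    using pseudo_divmod[OF M0 AB] M deg by auto
  have "F - [:p:] * B = M * (Q + [:p:] * A)"
    using R unfolding eq by (simp add: algebra_simps)
  moreover have "degree (F - [:p:] * B) < degree M"
    using deg B by (intro degree_diff_less) (auto intro: le_less_trans[OF degree_smult_le])
  ultimately have "F - [:p:] * B = 0"
    using degree_mult_right_le[of "Q + [:p:] * A" M]
    by (cases "Q + [:p:] * A = 0") auto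
  then have "F = [:p:] * B"
    by (simp only: right_minus_eq)
  then show ?thesis by (rule dvdI)
qed

text \<open>Otherwise the product of the \<open>[:-u j, 1:] ^ s\<close> is monic, has degree above
  that of \<open>F\<close>, and divides \<open>F\<close> modulo \<open>p\<close>.\<close>

lemma roots_mod_prime_degree:
  fixes F :: "int poly" and u :: "'a \<Rightarrow> int"
  assumes p: "prime p" and fin: "finite J"
    and u: "\<And>i j. i \<in> J \<Longrightarrow> j \<in> J \<Longrightarrow> i \<noteq> j \<Longrightarrow> \<not> p dvd u i - u j"
    and F: "\<And>j. j \<in> J \<Longrightarrow> \<exists>Q. [:p:] dvd F - [:-u j, 1:] ^ s * Q"
    and nz: "\<not> [:p:] dvd F"
  shows "s * card J \<le> degree F"
proof (rule ccontr)
  assume less: "\<not> s * card J \<le> degree F"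
  define M where "M = (\<Prod>j\<in>J. [:-u j, 1:] ^ s)"
  have "\<exists>Q. [:p:] dvd F - M * Q"
    unfolding M_def by (rule prod_linear_powers_dvd_mod[OF p fin]) (use u F in auto)
  then obtain Q where Q: "[:p:] dvd F - M * Q" ..
  have "degree M = s * card J"
    unfolding M_def by (subst degree_prod_eq_sum_degree) (auto simp: degree_power_eq)
  moreover have "lead_coeff M = 1"
    unfolding M_def by (simp add: lead_coeff_prod lead_coeff_power)
  ultimately show False
    using monic_multiple_mod_degree[OF _ _ Q] nz less by auto
qed

section \<open>The auxiliary polynomial and the bound on runs\<close>

lemma residue_run_bound:
  fixes p m s :: nat and b c :: int
  assumes p: "prime p" and b: "\<not> int p dvd b" and m: "m > 0" and less: "m + s < p"
    and run: "\<And>i. i < 2 * s \<Longrightarrow> int p dvd c + b * int i \<or> [(c + b * int i) ^ m = 1] (mod int p)"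
  shows "s * s \<le> m"
proof (cases "s = 0")
  case False
  define n where "n = m + s"
  define e :: "nat \<Rightarrow> int" where "e i = (-1) ^ (s + i) * int (s choose i)" for i
  \<comment> \<open>The sum is \<open>\<Delta>^s x^n\<close>; the constant is
    \<open>\<Delta>^s x^s\<close>, chosen to cancel the Taylor coefficient of order 0 modulo
    \<open>p\<close>.\<close>
  define F where "F = (\<Sum>i\<le>s. smult (e i) ([:b * int i, 1:] ^ n)) - [:b ^ s * fact s:]"
  have p': "prime (int p)"
    using p by simp
  have diff: "(\<Sum>i\<le>s. e i * (x + b * int i) ^ j) = (if j = s then b ^ s * fact s else 0)"
    if "j \<le> s" for x j
    using finite_difference_power[OF that, of x b] by (simp add: e_def)
  \<comment> \<open>The subtracted constant affects only \<open>d = 0\<close>; as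
    \<open>m > 0\<close>, the formula covers the coefficient at \<open>m\<close>.\<close>
  have coeffF: "coeff F d = int (n choose d) * (\<Sum>i\<le>s. e i * (0 + b * int i) ^ (n - d))"
    if "0 < d" "d \<le> n" for d
    using that by (simp add: F_def coeff_sum coeff_linear_poly_power sum_distrib_left mult_ac
      coeff_pCons split: nat.split)
  have "degree F \<le> m"
  \<comment> \<open>For \<open>m < d \<le> n\<close> the coefficient is a multiple of the
    \<open>s\<close>-th difference of a power \<open>n - d < s\<close>.\<close>
  proof (rule degree_le, intro allI impI)
    fix d assume d: "m < d"
    show "coeff F d = 0"
    proof (cases "d \<le> n")
      case True
      then have "n - d < s" using d by (simp add: n_def)
      then show ?thesis
        using coeffF[of d] diff[of "n - d" 0] d True by simp
    next
      case False
      have "coeff ([:b * int i, 1:] ^ n) d = 0" for i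
        using False by (intro coeff_eq_0) (simp add: degree_power_eq)
      then show ?thesis
        using d by (simp add: F_def coeff_sum coeff_pCons split: nat.split)
    qed
  qed
  moreover have "\<not> [:int p:] dvd F"
  proof
    assume "[:int p:] dvd F"
    then have "int p dvd coeff F m"
      by (simp add: const_poly_dvd_iff)
    also have "coeff F m = int (n choose m) * (b ^ s * fact s)"
      using coeffF[of m] diff[of s 0] m by (simp add: n_def)
    finally have "int p dvd int (n choose m) \<or> int p dvd b ^ s \<or> int p dvd fact s"
      using p' by (simp only: prime_dvd_mult_iff)
    moreover have "\<not> int p dvd b ^ s"
      using b p' prime_dvd_power by blast
    ultimately have "int p dvd int (n choose m) \<or> int p dvd fact s"
      by blast
    then have "p dvd n choose m \<or> p dvd fact s"
      by (metis int_dvd_int_iff of_nat_fact)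
    \<comment> \<open>As \<open>n = m + s < p\<close>, the factorial of \<open>n\<close> has no
      factor \<open>p\<close>.\<close>
    moreover have "(n choose m) dvd fact n"
      using binomial_fact_lemma[of m n] by (metis dvd_triv_right n_def le_add1)
    ultimately have "p dvd fact n \<or> p dvd fact s"
      using dvd_trans by blast
    then show False
      using less p by (simp add: prime_dvd_fact_iff n_def)
  qed
  moreover have "\<exists>Q. [:int p:] dvd F - [:-(c + b * int j), 1:] ^ s * Q" if j: "j < s" for j
  proof -
    define y where "y = [:-(c + b * int j), 1:]"
    \<comment> \<open>From \<open>j < s\<close> and \<open>i \<le> s\<close>, the index
      \<open>j + i\<close> stays below \<open>2 * s\<close>, the length of the run.\<close>
    define v where "v i = c + b * int (j + i)" for i
    define W where "W t = int (n choose t) * (\<Sum>i\<le>s. e i * v i ^ (n - t))" for t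
    define G where "G t = smult (W t) (y ^ t) - (if t = 0 then [:b ^ s * fact s:] else 0)" for t
    \<comment> \<open>The condition \<open>h > 0\<close> makes both powers vanish when
      \<open>p\<close> divides \<open>v i\<close>.\<close>
    have v_cong: "[v i ^ (m + h) = v i ^ h] (mod int p)" if "h > 0" "i \<le> s" for i h
    proof (cases "int p dvd v i")
      case True
      then have "int p dvd v i ^ (m + h)" "int p dvd v i ^ h"
        using that by (auto intro: dvd_power_same dvd_trans[OF _ dvd_power])
      then show ?thesis
        by (simp add: cong_iff_dvd_diff)
    next
      case False
      then have "[v i ^ m * v i ^ h = 1 * v i ^ h] (mod int p)"
        using run[of "j + i"] j that by (intro cong_mult) (auto simp: v_def)
      then show ?thesis
        by (simp add: power_add)
    qed
    have expand: "[:b * int i, 1:] ^ n = (\<Sum>t\<le>n. smult (int (n choose t) * v i ^ (n - t)) (y ^ t))" for i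
    proof -
      have "[:b * int i, 1:] = y + [:v i:]"
        by (simp add: y_def v_def algebra_simps)
      then have "[:b * int i, 1:] ^ n = (\<Sum>t\<le>n. of_nat (n choose t) * y ^ t * [:v i:] ^ (n - t))"
        by (simp only: binomial_ring)
      also have "\<dots> = (\<Sum>t\<le>n. smult (int (n choose t) * v i ^ (n - t)) (y ^ t))"
        by (intro sum.cong refl) (simp add: poly_const_pow of_nat_poly mult_ac)
      finally show ?thesis .
    qed
    have smult_distrib: "smult a (sum f A) = (\<Sum>t\<in>A. smult a (f t))"
      for a and f :: "nat \<Rightarrow> int poly" and A
      using sum_distrib_left[of "[:a:]" f A] by simp
    have "(\<Sum>i\<le>s. smult (e i) ([:b * int i, 1:] ^ n)) =
        (\<Sum>i\<le>s. \<Sum>t\<le>n. smult (e i * (int (n choose t) * v i ^ (n - t))) (y ^ t))"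
      unfolding expand smult_distrib by simp
    also have "\<dots> = (\<Sum>t\<le>n. smult (W t) (y ^ t))"
      by (subst sum.swap) (simp add: W_def smult_sum sum_distrib_left mult_ac)
    finally have "F = (\<Sum>t\<le>n. G t)"
      by (simp add: F_def G_def sum_subtractf)
    also have "{..n} = {..<s} \<union> {s..n}"
      by (auto simp: n_def)
    also have "sum G \<dots> = sum G {..<s} + sum G {s..n}"
      by (intro sum.union_disjoint) auto
    also have "sum G {s..n} = y ^ s * (\<Sum>t=s..n. smult (W t) (y ^ (t - s)))"
      unfolding sum_distrib_left using False
      by (intro sum.cong refl) (auto simp: G_def simp flip: power_add)
    finally have F_eq: "F - y ^ s * (\<Sum>t=s..n. smult (W t) (y ^ (t - s))) = sum G {..<s}"
      by simp
    \<comment> \<open>By \<open>v_cong\<close> with \<open>h = s - t\<close>, the exponent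
      \<open>n - t\<close> drops to \<open>s - t\<close>. The \<open>s\<close>-th difference of that
      power is zero for \<open>t > 0\<close>, and for \<open>t = 0\<close> it is the constant
      subtracted in \<open>F\<close>.\<close>
    have "[:int p:] dvd G t" if t: "t < s" for t
    proof -
      have n: "n - t = m + (s - t)"
        using t by (simp add: n_def)
      have "[W t = int (n choose t) * (\<Sum>i\<le>s. e i * v i ^ (s - t))] (mod int p)"
        unfolding W_def n using t by (intro cong_mult cong_sum cong_refl v_cong) simp_all
      also have "(\<Sum>i\<le>s. e i * v i ^ (s - t)) = (if t = 0 then b ^ s * fact s else 0)"
        using diff[of "s - t" "c + b * int j"] t by (auto simp: v_def algebra_simps)
      finally have "int p dvd W t - (if t = 0 then b ^ s * fact s else 0)"
        by (cases "t = 0") (auto simp: cong_iff_dvd_diff)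
      moreover have "G t = smult (W t - (if t = 0 then b ^ s * fact s else 0)) (y ^ t)"
        by (auto simp: G_def smult_diff_left)
      ultimately show ?thesis
        by (simp add: const_poly_dvd_iff)
    qed
    then show ?thesis
      using F_eq unfolding y_def by (metis (no_types, lifting) dvd_sum lessThan_iff)
  qed
  moreover have "\<not> int p dvd (c + b * int i) - (c + b * int j)"
    if "i \<in> {..<s}" "j \<in> {..<s}" "i \<noteq> j" for i j
  proof
    assume "int p dvd (c + b * int i) - (c + b * int j)"
    then have "int p dvd b * (int i - int j)"
      by (simp add: algebra_simps)
    then have "int p dvd int i - int j"
      using b p' by (simp add: prime_dvd_mult_iff)
    then have "int p \<le> \<bar>int i - int j\<bar>"
      using that by (intro zdvd_imp_le) auto
    then show False
      using that less by auto
  qed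
  ultimately have "s * card {..<s} \<le> m"
    using roots_mod_prime_degree[OF p', of "{..<s}" "\<lambda>j. c + b * int j" F s] by force
  then show ?thesis by simp
qed simp

section \<open>Power residues modulo \<open>p\<close>\<close>

lemma kth_power_nonresidue_mod_iff:
  assumes "prime p"
  shows "kth_power_nonresidue p k (a mod int p) \<longleftrightarrow> \<not> (\<exists>y. [y ^ k = a] (mod int p))"
proof -
  interpret residues_prime p "residue_ring (int p)"
    using assms by unfold_locales auto
  have carrier: "x mod int p \<in> carrier (residue_ring (int p))" for x
    using m_gt_one by (simp add: residue_ring_def)
  have "(\<exists>y\<in>carrier (residue_ring (int p)). y [^]\<^bsub>residue_ring (int p)\<^esub> k = a mod int p) \<longleftrightarrow>
      (\<exists>y. [y ^ k = a] (mod int p))"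
  proof
    assume "\<exists>y\<in>carrier (residue_ring (int p)). y [^]\<^bsub>residue_ring (int p)\<^esub> k = a mod int p"
    then obtain y where "y \<in> {0..int p - 1}" "y [^]\<^bsub>residue_ring (int p)\<^esub> k = a mod int p"
      by (auto simp: residue_ring_def)
    then have "[y ^ k = a] (mod int p)"
      using pow_cong[of y k] by (simp add: cong_def)
    then show "\<exists>y. [y ^ k = a] (mod int p)" ..
  next
    assume "\<exists>y. [y ^ k = a] (mod int p)"
    then show "\<exists>y\<in>carrier (residue_ring (int p)). y [^]\<^bsub>residue_ring (int p)\<^esub> k = a mod int p"
      using pow_cong carrier by (metis cong_def)
  qed
  then show ?thesis
    using carrier by (simp add: kth_power_nonresidue_def)
qed

text \<open>By Fermat, since \<open>a ^ ((p - 1) div k)\<close> is congruent to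
  \<open>y ^ (p - 1)\<close>.\<close>

lemma kth_power_mod_euler:
  fixes a :: int
  assumes p: "prime p" and k: "k dvd p - 1" and y: "[y ^ k = a] (mod int p)" and a: "\<not> int p dvd a"
  shows "[a ^ ((p - 1) div k) = 1] (mod int p)"
proof (cases "k = 0")
  case True
  then show ?thesis using k by simp
next
  case False
  interpret residues_prime p "residue_ring (int p)"
    using p by unfold_locales auto
  have "\<not> int p dvd y"
    using y a False by (metis cong_dvd_iff dvd_power dvd_trans neq0_conv)
  then have "coprime y (int p)"
    using p by (metis coprime_commute prime_imp_coprime prime_nat_int_transfer)
  then have "[y ^ (p - 1) = 1] (mod int p)"
    using euler_theorem[of y] totient_prime[OF p] by simp
  moreover have "y ^ (p - 1) = (y ^ k) ^ ((p - 1) div k)"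
    using k by (simp flip: power_mult)
  moreover have "[(y ^ k) ^ ((p - 1) div k) = a ^ ((p - 1) div k)] (mod int p)"
    using y by (rule cong_pow)
  ultimately show ?thesis
    by (metis cong_sym cong_trans)
qed

text \<open>Otherwise all \<open>p - 1\<close> nonzero residues would be roots modulo
  \<open>p\<close> of \<open>x^m - 1\<close>, whose degree is \<open>m < p - 1\<close>.\<close>

lemma ex_kth_power_nonresidue:
  assumes p: "prime p" and k: "k dvd p - 1" "k > 1"
  shows "\<exists>a. \<not> (\<exists>y. [y ^ k = a] (mod int p))"
proof (rule ccontr)
  assume all: "\<not> (\<exists>a. \<not> (\<exists>y. [y ^ k = a] (mod int p)))"
  define m where "m = (p - 1) div k"
  have p1: "p - 1 > 0"
    using prime_gt_1_nat[OF p] by simp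
  have m: "m < p - 1" "m > 0"
    using p1 k by (auto simp: m_def div_greater_zero_iff dvd_imp_le)
  define F :: "int poly" where "F = monom 1 m - 1"
  have "degree F \<le> m"
    unfolding F_def by (intro degree_diff_le) (auto simp: degree_monom_eq)
  have "coeff F m = 1"
    using m by (simp add: F_def)
  have "1 * card {1..<p} \<le> degree F"
  proof (rule roots_mod_prime_degree[of "int p" _ int])
    show "\<not> [:int p:] dvd F"
      using \<open>coeff F m = 1\<close> p by (metis const_poly_dvd_iff not_prime_unit prime_nat_int_transfer)
    show "\<exists>Q. [:int p:] dvd F - [:- int j, 1:] ^ 1 * Q" if j: "j \<in> {1..<p}" for j
    proof -
      have "\<not> int p dvd int j"
        using j by (auto dest: zdvd_imp_le)
      then have "[int j ^ m = 1] (mod int p)"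
        using all kth_power_mod_euler[OF p k(1)] unfolding m_def by blast
      then have "int p dvd poly F (int j)"
        by (simp add: F_def poly_monom cong_iff_dvd_diff)
      moreover have "[:- int j, 1:] dvd F - [:poly F (int j):]"
        by (simp add: poly_eq_0_iff_dvd[symmetric])
      then obtain Q where "F - [:poly F (int j):] = [:- int j, 1:] * Q" ..
      ultimately show ?thesis
        by (intro exI[of _ Q]) (simp add: algebra_simps)
    qed
    show "\<not> int p dvd int i - int j" if "i \<in> {1..<p}" "j \<in> {1..<p}" "i \<noteq> j" for i j
    proof
      assume "int p dvd int i - int j"
      then have "int p \<le> \<bar>int i - int j\<bar>"
        using that by (intro zdvd_imp_le) auto
      then show False using that by auto
    qed
  qed (use p in auto)
  then show False
    using \<open>degree F \<le> m\<close> m by simp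
qed

text \<open>As \<open>b\<close> is invertible modulo \<open>p\<close>, the first \<open>p\<close>
  terms meet every residue class; solving for the index of a known non-residue \<open>a\<close>
  gives \<open>n\<close>.\<close>

lemma ex_ap_nonresidue_less:
  assumes p: "prime p" and k: "k dvd p - 1" "k > 1" and b: "\<not> int p dvd b"
  shows "\<exists>n<p. kth_power_nonresidue p k ((b * int n + c) mod int p)"
proof -
  obtain a where a: "\<not> (\<exists>y. [y ^ k = a] (mod int p))"
    using ex_kth_power_nonresidue[OF p k] by blast
  have "coprime b (int p)"
    using p b by (metis coprime_commute prime_imp_coprime prime_nat_int_transfer)
  then obtain x where x: "[b * x = 1] (mod int p)"
    using cong_solve_coprime_int by blast
  define n where "n = nat ((x * (a - c)) mod int p)"
  have p0: "int p > 0"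
    using prime_gt_0_nat[OF p] by simp
  have "int n = (x * (a - c)) mod int p"
    using p0 by (simp add: n_def)
  then have "n < p" and n: "[int n = x * (a - c)] (mod int p)"
    using p0 pos_mod_bound[OF p0, of "x * (a - c)"] by (auto simp: cong_def)
  have "[b * int n + c = b * (x * (a - c)) + c] (mod int p)"
    using n by (intro cong_add cong_mult cong_refl)
  also have "b * (x * (a - c)) + c = (b * x) * (a - c) + c"
    by simp
  also have "[\<dots> = 1 * (a - c) + c] (mod int p)"
    using x by (intro cong_add cong_mult cong_refl)
  finally have "[b * int n + c = a] (mod int p)"
    by simp
  then have "\<not> (\<exists>y. [y ^ k = b * int n + c] (mod int p))"
    using a by (meson cong_trans)
  then show ?thesis
    using \<open>n < p\<close> by (auto simp: kth_power_nonresidue_mod_iff[OF p])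
qed

section \<open>The bound for arithmetic progressions\<close>

lemma kth_power_run_bound:
  assumes p: "prime p" and k: "k dvd p - 1" "k > 1" and b: "\<not> int p dvd b"
    and run: "\<And>n. n < N \<Longrightarrow> \<not> kth_power_nonresidue p k ((b * int n + c) mod int p)"
  shows "real N \<le> 2 * sqrt ((real p - 1) / real k) + 1"
proof (rule ccontr)
  assume contr: "\<not> ?thesis"
  define m where "m = (p - 1) div k"
  have p1: "p > 1"
    using prime_gt_1_nat[OF p] .
  have pm: "p - 1 = k * m"
    using k by (simp add: m_def)
  have m0: "m > 0"
    using pm p1 by (cases m) auto
  have "real p - 1 = real k * real m"
    using pm p1 by (metis One_nat_def Suc_leI Suc_lessD of_nat_1 of_nat_diff of_nat_mult)
  then have m: "(real p - 1) / real k = real m"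
    using k by simp
  have N: "N < p"
    using ex_ap_nonresidue_less[OF p k b, of c] run by (meson not_less order.strict_trans2)
  define r where "r = nat \<lfloor>sqrt (real m)\<rfloor>"
  have r: "real r \<le> sqrt (real m)" "sqrt (real m) < real r + 1"
    by (auto simp: r_def)
  \<comment> \<open>By integrality the excess over \<open>2 * r + 1\<close> leaves room for a run of
    length \<open>2 * s\<close> with \<open>s = r + 1\<close>.\<close>
  have "real N > real (2 * r + 1)"
    using contr r by (simp add: m)
  then have rN: "2 * (r + 1) \<le> N"
    unfolding of_nat_less_iff by simp
  have "real (r * r) \<le> real m"
    using mult_mono[OF r(1) r(1)] by simp
  then have rm: "r * r \<le> m"
    unfolding of_nat_le_iff .
  have "real m < real ((r + 1) * (r + 1))"
    using mult_strict_mono[OF r(2) r(2)] by (simp add: algebra_simps)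
  then have mr: "m < (r + 1) * (r + 1)"
    unfolding of_nat_less_iff .
  have r0: "r > 0"
    using mr m0 by (cases r) auto
  have "2 * m \<le> p - 1"
    using pm k by simp
  have "m + (r + 1) < p"
  proof (cases "r = 1")
    case True
    \<comment> \<open>Here \<open>2 * r \<le> r * r\<close> fails; instead
      \<open>4 \<le> N < p\<close> rules out \<open>m = 1\<close>, \<open>p = 3\<close>.\<close>
    then show ?thesis using rN N rm mr \<open>2 * m \<le> p - 1\<close> by simp
  next
    case False
    then have "2 * r \<le> m"
      using r0 rm mult_le_mono1[of 2 r r] by linarith
    then show ?thesis using \<open>2 * m \<le> p - 1\<close> r0 p1 False by linarith
  qed
  then have "(r + 1) * (r + 1) \<le> m"
  proof (rule residue_run_bound[OF p b m0])
    fix i assume "i < 2 * (r + 1)"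
    then obtain y where "[y ^ k = b * int i + c] (mod int p)"
      using run[of i] rN kth_power_nonresidue_mod_iff[OF p] by auto
    then show "int p dvd c + b * int i \<or> [(c + b * int i) ^ m = 1] (mod int p)"
      using kth_power_mod_euler[OF p k(1)] unfolding m_def by (metis add.commute)
  qed
  then show False
    using mr by simp
qed

text \<open>For \<open>k = 1\<close> every element is a \<open>k\<close>-th power, and for
  \<open>p\<close> dividing \<open>b\<close> the progression is constant modulo \<open>p\<close>, so
  there may be no non-residue. Existence is therefore a separate conjunct, and the bound concerns
  any least element.\<close>

theorem theorem1p1:
  fixes p k :: nat and b c :: int
  assumes "prime p" and "k > 0" and "k dvd p - 1" and "b \<ge> 0"
  shows "(k > 1 \<and> \<not> int p dvd b \<longrightarrow> (\<exists>m. is_least_of m (ap_nonresidues p k b c))) \<and>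
         (\<forall>m. is_least_of m (ap_nonresidues p k b c) \<longrightarrow>
            real_of_int m \<le> 7 / sqrt 5 * real_of_int b * sqrt ((real p - 1) / real k)
                             + 4 * real_of_int b + real_of_int c)"
proof (intro conjI impI allI)
  assume kb: "k > 1 \<and> \<not> int p dvd b"
  define P where "P n \<longleftrightarrow> kth_power_nonresidue p k ((b * int n + c) mod int p)" for n
  have ex: "\<exists>n. P n"
    using ex_ap_nonresidue_less[OF assms(1,3)] kb unfolding P_def by blast
  \<comment> \<open>With \<open>b \<ge> 0\<close> the terms are nondecreasing in \<open>n\<close>,
    so the least index gives the least value.\<close>
  have "is_least_of (b * int (LEAST n. P n) + c) (ap_nonresidues p k b c)"
    unfolding is_least_of_def ap_nonresidues_def
    using LeastI_ex[OF ex] Least_le[of P] assms(4)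
    unfolding P_def[symmetric] by (blast intro: add_right_mono mult_left_mono iffD2[OF of_nat_le_iff])
  then show "\<exists>m. is_least_of m (ap_nonresidues p k b c)" ..
next
  fix l assume l: "is_least_of l (ap_nonresidues p k b c)"
  then obtain N where N: "l = b * int N + c"
      "kth_power_nonresidue p k ((b * int N + c) mod int p)"
    by (auto simp: is_least_of_def ap_nonresidues_def)
  have least: "l \<le> b * int n + c" if "kth_power_nonresidue p k ((b * int n + c) mod int p)" for n
    using l that by (auto simp: is_least_of_def ap_nonresidues_def)
  define S where "S = sqrt ((real p - 1) / real k)"
  have S: "S \<ge> 0"
    using prime_gt_0_nat[OF assms(1)] by (simp add: S_def)
  have "sqrt 5 \<le> 7 / 2"
    by (rule real_le_lsqrt) (auto simp: power2_eq_square)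
  then have coef: "2 \<le> 7 / sqrt 5"
    by (simp add: field_simps)
  have "real_of_int l \<le> real_of_int b * (2 * S + 1) + real_of_int c"
  proof (cases "int p dvd b")
    case True
    \<comment> \<open>All terms agree modulo \<open>p\<close>, so the term \<open>c\<close> at index
      0 is already a non-residue.\<close>
    then have "(b * int N + c) mod int p = (b * int 0 + c) mod int p"
      by (metis cong_def cong_add_rcancel cong_0_iff dvd_mult2 mult_zero_right of_nat_0)
    then have "l \<le> c"
      using least[of 0] N by simp
    moreover have "0 \<le> real_of_int b * (2 * S + 1)"
      using S assms(4) by simp
    ultimately show ?thesis by linarith
  next
    case False
    then have "b > 0"
      using assms(4) by (cases "b = 0") auto
    have "k \<noteq> 1"
      using N(2) cong_refl unfolding kth_power_nonresidue_mod_iff[OF assms(1)]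
      by (metis power_one_right)
    then have "k > 1"
      using assms(2) by simp
    \<comment> \<open>With \<open>b > 0\<close> earlier terms are strictly smaller, so minimality
      makes the first \<open>N\<close> terms a run of residues.\<close>
    have "\<not> kth_power_nonresidue p k ((b * int n + c) mod int p)" if "n < N" for n
      using least[of n] \<open>b > 0\<close> that N(1) by auto
    then have "real N \<le> 2 * S + 1"
      unfolding S_def using kth_power_run_bound[OF assms(1,3) \<open>k > 1\<close> False] by blast
    then have "real_of_int b * real N \<le> real_of_int b * (2 * S + 1)"
      using \<open>b > 0\<close> by (intro mult_left_mono) auto
    then show ?thesis
      by (simp add: N(1))
  qed
  also have "real_of_int b * (2 * S + 1) \<le> real_of_int b * (7 / sqrt 5 * S + 4)"
    using assms(4) S coef by (intro mult_left_mono add_mono mult_right_mono) auto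
  finally show "real_of_int l \<le> 7 / sqrt 5 * real_of_int b * sqrt ((real p - 1) / real k)
                             + 4 * real_of_int b + real_of_int c"
    by (simp add: S_def algebra_simps)
qed

end
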